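(* Let $(A,\rhd,\lhd,\mathfrak{B})$ be a skew-symmetric Frobenius dialgebra and let $(A,[\cdot,\cdot])$ be the sub-adjacent Leibniz algebra of $(A,\rhd,\lhd)$, i.e. $[x,y]=x\rhd y-y\lhd x$ for all $x,y\in A$. Then $(A,[\cdot,\cdot],\mathfrak{B})$ is a quadratic Leibniz algebra.
   Context: All vector spaces and algebras are finite-dimensional over a field $\mathbb F$ of characteristic $0$; algebras are not assumed unital. A dialgebra is a triple $(A,\rhd,\lhd)$ where $\rhd,\lhd$ are associative bilinear products on a vector space $A$ such that for all $x,y,z\in A$: $(x\lhd y)\lhd z=x\lhd(y\rhd z)$, $(x\rhd y)\lhd z=x\rhd(y\lhd z)$, $(x\lhd y)\rhd z=x\rhd(y\rhd z)$. A bilinear form $\mathfrak{B}$ on a dialgebra is invariant if $\mathfrak{B}(x\rhd y,z)=\mathfrak{B}(x,y\rhd z-y\lhd z)$ and $\mathfrak{B}(x\lhd y,z)=\mathfrak{B}(x,y\rhd z)$. A skew-symmetric Frobenius dialgebra is a dialgebra equipped with a nondegenerate skew-symmetric invariant bilinear form. A Leibniz algebra $(A,[\cdot,\cdot])$ is a vector space with a bilinear bracket satisfying $[x,[y,z]]=[[x,y],z]+[y,[x,z]]$. It is known that for a dialgebra, $[x,y]=x\rhd y-y\lhd x$ defines a Leibniz algebra, called the sub-adjacent Leibniz algebra. A quadratic Leibniz algebra $(A,[\cdot,\cdot],\mathfrak{B})$ is a Leibniz algebra with a nondegenerate skew-symmetric bilinear form satisfying $\mathfrak{B}([x,y],z)=\mathfrak{B}(x,[y,z]+[z,y])$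 for all $x,y,z\in A$. *)

theory Defs
  imports Complex_Main
begin

text \<open>A vector space is a whole type of class \<open>ab_group_add\<close> together with a scalar multiplication,
  as in \<open>HOL.Vector_Spaces\<close>; the ground field is a type of class \<open>field_char_0\<close>.\<close>

locale fin_dim_vector_space_char_0 = vector_space scale
  for scale :: "'f::field_char_0 \<Rightarrow> 'v::ab_group_add \<Rightarrow> 'v"  (infixr "*s" 75) +
  assumes finite_dimensional: "\<exists>Basis. finite_dimensional_vector_space scale Basis"

definition bilinear_product ::
  "('f::field \<Rightarrow> 'v::ab_group_add \<Rightarrow> 'v) \<Rightarrow> ('v \<Rightarrow> 'v \<Rightarrow> 'v) \<Rightarrow> bool" where
  "bilinear_product scale m \<longleftrightarrow>
     (\<forall>x. Vector_Spaces.linear scale scale (\<lambda>y. m x y)) \<and>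
     (\<forall>y. Vector_Spaces.linear scale scale (\<lambda>x. m x y))"

definition bilinear_form ::
  "('f::field \<Rightarrow> 'v::ab_group_add \<Rightarrow> 'v) \<Rightarrow> ('v \<Rightarrow> 'v \<Rightarrow> 'f) \<Rightarrow> bool" where
  "bilinear_form scale B \<longleftrightarrow>
     (\<forall>x. Vector_Spaces.linear scale (*) (\<lambda>y. B x y)) \<and>
     (\<forall>y. Vector_Spaces.linear scale (*) (\<lambda>x. B x y))"

definition skew_symmetric_form :: "('v \<Rightarrow> 'v \<Rightarrow> 'f::field) \<Rightarrow> bool" where
  "skew_symmetric_form B \<longleftrightarrow> (\<forall>x y. B x y = - B y x)"

definition nondegenerate_form :: "('v::ab_group_add \<Rightarrow> 'v \<Rightarrow> 'f::field) \<Rightarrow> bool" where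
  "nondegenerate_form B \<longleftrightarrow>
     (\<forall>x. (\<forall>y. B x y = 0) \<longrightarrow> x = 0) \<and> (\<forall>y. (\<forall>x. B x y = 0) \<longrightarrow> y = 0)"

locale dialgebra = fin_dim_vector_space_char_0 scale
  for scale :: "'f::field_char_0 \<Rightarrow> 'v::ab_group_add \<Rightarrow> 'v"  (infixr "*s" 75) +
  fixes rprod :: "'v \<Rightarrow> 'v \<Rightarrow> 'v"  (infixl "\<rhd>" 70)
    and lprod :: "'v \<Rightarrow> 'v \<Rightarrow> 'v"  (infixl "\<lhd>" 70)
  assumes rprod_bilinear: "bilinear_product scale (\<rhd>)"
    and lprod_bilinear: "bilinear_product scale (\<lhd>)"
    and rprod_assoc: "(x \<rhd> y) \<rhd> z = x \<rhd> (y \<rhd> z)"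
    and lprod_assoc: "(x \<lhd> y) \<lhd> z = x \<lhd> (y \<lhd> z)"
    and lprod_lprod: "(x \<lhd> y) \<lhd> z = x \<lhd> (y \<rhd> z)"
    and rprod_lprod: "(x \<rhd> y) \<lhd> z = x \<rhd> (y \<lhd> z)"
    and lprod_rprod: "(x \<lhd> y) \<rhd> z = x \<rhd> (y \<rhd> z)"

definition invariant_form ::
  "('v::ab_group_add \<Rightarrow> 'v \<Rightarrow> 'v) \<Rightarrow> ('v \<Rightarrow> 'v \<Rightarrow> 'v) \<Rightarrow> ('v \<Rightarrow> 'v \<Rightarrow> 'f::field) \<Rightarrow> bool" where
  "invariant_form rprod lprod B \<longleftrightarrow>
     (\<forall>x y z. B (rprod x y) z = B x (rprod y z - lprod y z)) \<and>
     (\<forall>x y z. B (lprod x y) z = B x (rprod y z))"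

locale skew_symmetric_frobenius_dialgebra = dialgebra scale rprod lprod
  for scale :: "'f::field_char_0 \<Rightarrow> 'v::ab_group_add \<Rightarrow> 'v"  (infixr "*s" 75)
    and rprod :: "'v \<Rightarrow> 'v \<Rightarrow> 'v"  (infixl "\<rhd>" 70)
    and lprod :: "'v \<Rightarrow> 'v \<Rightarrow> 'v"  (infixl "\<lhd>" 70) +
  fixes B :: "'v \<Rightarrow> 'v \<Rightarrow> 'f"
  assumes form_bilinear: "bilinear_form scale B"
    and form_skew_symmetric: "skew_symmetric_form B"
    and form_nondegenerate: "nondegenerate_form B"
    and form_invariant: "invariant_form (\<rhd>) (\<lhd>) B"

locale leibniz_algebra = fin_dim_vector_space_char_0 scale
  for scale :: "'f::field_char_0 \<Rightarrow> 'v::ab_group_add \<Rightarrow> 'v"  (infixr "*s" 75) +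
  fixes bracket :: "'v \<Rightarrow> 'v \<Rightarrow> 'v"
  assumes bracket_bilinear: "bilinear_product scale bracket"
    and leibniz: "bracket x (bracket y z) = bracket (bracket x y) z + bracket y (bracket x z)"

locale quadratic_leibniz_algebra = leibniz_algebra scale bracket
  for scale :: "'f::field_char_0 \<Rightarrow> 'v::ab_group_add \<Rightarrow> 'v"  (infixr "*s" 75)
    and bracket :: "'v \<Rightarrow> 'v \<Rightarrow> 'v" +
  fixes B :: "'v \<Rightarrow> 'v \<Rightarrow> 'f"
  assumes form_bilinear: "bilinear_form scale B"
    and form_skew_symmetric: "skew_symmetric_form B"
    and form_nondegenerate: "nondegenerate_form B"
    and form_invariant: "B (bracket x y) z = B x (bracket y z + bracket z y)"

definition sub_adjacent_bracket ::
  "('v::ab_group_add \<Rightarrow> 'v \<Rightarrow> 'v) \<Rightarrow> ('v \<Rightarrow> 'v \<Rightarrow> 'v) \<Rightarrow> 'v \<Rightarrow> 'v \<Rightarrow> 'v" where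
  "sub_adjacent_bracket rprod lprod x y = rprod x y - lprod y x"

end

theory Submission imports Defs begin

text \<open>Bilinearity, skew-symmetry and nondegeneracy concern \<open>B\<close> alone, so they
  carry over unchanged. Two computations remain. The Leibniz identity
  (\<open>leibniz_algebra_sub_adjacent_bracket\<close>) follows from the dialgebra axioms alone:
  expanding the brackets gives triple products that the axioms rebracket until they cancel.
  Compatibility of \<open>B\<close> with the bracket (\<open>form_sub_adjacent_bracket\<close>)
  joins invariance with skew-symmetry: in \<open>y \<lhd> x\<close> the element \<open>x\<close>
  stands second, and skew-symmetry brings it to the first slot of \<open>B\<close>.\<close>

lemma bilinear_product_additive:
  assumes "bilinear_product scale m"
  shows "m x (y + z) = m x y + m x z" "m (x + y) z = m x z + m y z"
    "m x (y - z) = m x y - m x z" "m (x - y) z = m x z - m y z"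
proof -
  interpret r: Vector_Spaces.linear scale scale "\<lambda>y. m x y" for x
    using assms by (simp add: bilinear_product_def)
  interpret l: Vector_Spaces.linear scale scale "\<lambda>x. m x y" for y
    using assms by (simp add: bilinear_product_def)
  show "m x (y + z) = m x y + m x z" "m (x + y) z = m x z + m y z"
    "m x (y - z) = m x y - m x z" "m (x - y) z = m x z - m y z"
    by (rule r.add l.add r.diff l.diff)+
qed

lemma bilinear_form_additive:
  assumes "bilinear_form scale B"
  shows "B x (y + z) = B x y + B x z" "B (x + y) z = B x z + B y z"
    "B x (y - z) = B x y - B x z" "B (x - y) z = B x z - B y z"
proof -
  interpret r: Vector_Spaces.linear scale "(*)" "\<lambda>y. B x y" for x
    using assms by (simp add: bilinear_form_def)
  interpret l: Vector_Spaces.linear scale "(*)" "\<lambda>x. B x y" for y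
    using assms by (simp add: bilinear_form_def)
  show "B x (y + z) = B x y + B x z" "B (x + y) z = B x z + B y z"
    "B x (y - z) = B x y - B x z" "B (x - y) z = B x z - B y z"
    by (rule r.add l.add r.diff l.diff)+
qed

lemma bilinear_product_sub_adjacent_bracket:
  assumes "vector_space scale" "bilinear_product scale rprod" "bilinear_product scale lprod"
  shows "bilinear_product scale (sub_adjacent_bracket rprod lprod)"
proof -
  interpret vector_space_pair scale scale
    using assms(1) by (simp add: vector_space_pair_def)
  show ?thesis
    using assms(2,3) unfolding bilinear_product_def sub_adjacent_bracket_def
    by (auto intro: linear_compose_sub)
qed

context dialgebra
begin

text \<open>After rebracketing, the right-hand side of the Leibniz identity has two cancelling
  pairs, \<open>y \<rhd> (x \<rhd> z)\<close> and \<open>(z \<lhd> x) \<lhd> y\<close>; its other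
  four terms are the expansion of the left-hand side.\<close>

lemma leibniz_algebra_sub_adjacent_bracket:
  "leibniz_algebra scale (sub_adjacent_bracket rprod lprod)"
proof
  show "bilinear_product scale (sub_adjacent_bracket rprod lprod)"
    by (rule bilinear_product_sub_adjacent_bracket[OF vector_space_axioms
          rprod_bilinear lprod_bilinear])
next
  fix x y z
  \<comment> \<open>These instances, read left to right, give each triple product in the expansion a
    normal form: \<open>u \<rhd> (v \<rhd> w)\<close>, \<open>(u \<rhd> v) \<lhd> w\<close> or
    \<open>(u \<lhd> v) \<lhd> w\<close>. What is left is arithmetic in an abelian group.\<close>
  have "x \<rhd> (z \<lhd> y) = (x \<rhd> z) \<lhd> y" "z \<lhd> (x \<rhd> y) = (z \<lhd> x) \<lhd> y"
    "(y \<lhd> x) \<rhd> z = y \<rhd> (x \<rhd> z)" "(x \<rhd> y) \<rhd> z = x \<rhd> (y \<rhd> z)"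
    "z \<lhd> (y \<lhd> x) = (z \<lhd> y) \<lhd> x" "y \<rhd> (z \<lhd> x) = (y \<rhd> z) \<lhd> x"
    by (rule rprod_lprod[symmetric] lprod_lprod[symmetric] lprod_assoc[symmetric]
        lprod_rprod rprod_assoc)+
  then show "sub_adjacent_bracket rprod lprod x (sub_adjacent_bracket rprod lprod y z) =
      sub_adjacent_bracket rprod lprod (sub_adjacent_bracket rprod lprod x y) z +
      sub_adjacent_bracket rprod lprod y (sub_adjacent_bracket rprod lprod x z)"
    by (simp add: sub_adjacent_bracket_def bilinear_product_additive[OF rprod_bilinear]
        bilinear_product_additive[OF lprod_bilinear])
qed

end

context skew_symmetric_frobenius_dialgebra
begin

lemma form_sub_adjacent_bracket:
  "B (sub_adjacent_bracket rprod lprod x y) z =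
    B x (sub_adjacent_bracket rprod lprod y z + sub_adjacent_bracket rprod lprod z y)"
proof -
  have inv: "B (u \<rhd> v) w = B u (v \<rhd> w - v \<lhd> w)" "B (u \<lhd> v) w = B u (v \<rhd> w)" for u v w
    using form_invariant by (simp_all add: invariant_form_def)
  \<comment> \<open>Invariance turns the left side into \<open>B y (x \<rhd> z)\<close>, and
    skew-symmetry swaps its arguments. Now \<open>x\<close> is the left factor of a product in the
    first slot, so invariance for \<rhd> can move \<open>z\<close> across.\<close>
  have "B (y \<lhd> x) z = - B (x \<rhd> z) y"
    using form_skew_symmetric inv(2) by (metis skew_symmetric_form_def)
  also have "\<dots> = B x (z \<lhd> y) - B x (z \<rhd> y)"
    by (simp add: inv(1) bilinear_form_additive[OF form_bilinear])
  finally show ?thesis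
    \<comment> \<open>Subtracting this from
      \<open>B (x \<rhd> y) z = B x (y \<rhd> z - y \<lhd> z)\<close> pairs \<open>x\<close> with
      all four products of \<open>y\<close> and \<open>z\<close>, which regroup as the symmetrised
      bracket.\<close>
    by (simp add: sub_adjacent_bracket_def inv(1) bilinear_form_additive[OF form_bilinear])
qed

end

theorem proposition2p25:
  fixes scale :: "'f::field_char_0 \<Rightarrow> 'v::ab_group_add \<Rightarrow> 'v"
    and rprod lprod :: "'v \<Rightarrow> 'v \<Rightarrow> 'v"
    and B :: "'v \<Rightarrow> 'v \<Rightarrow> 'f"
  assumes "skew_symmetric_frobenius_dialgebra scale rprod lprod B"
  shows "quadratic_leibniz_algebra scale (sub_adjacent_bracket rprod lprod) B"
proof -
  interpret skew_symmetric_frobenius_dialgebra scale rprod lprod B by (rule assms)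
  show ?thesis
    by (intro quadratic_leibniz_algebra.intro quadratic_leibniz_algebra_axioms.intro
        leibniz_algebra_sub_adjacent_bracket form_bilinear form_skew_symmetric
        form_nondegenerate form_sub_adjacent_bracket)
qed

end
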